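(* Let $K\ge 1$ be an integer, let $d_1,\dots,d_{K+1}>0$, let $P_0,P_1,\alpha_1,\alpha_2,\alpha_3>0$, let $V_{\max}>0$, $\Delta V\ge 0$, let $\tau_1,\dots,\tau_K\ge 0$ and $\eta_1,\dots,\eta_K\in\mathbb{R}$, let $(u_1,\dots,u_K)$ be a fixed permutation of $(1,\dots,K)$, and let $E_{\mathrm{hov},i},E_{\mathrm{com},i}\in\mathbb{R}$ ($1\le i\le K+1$) be constants. Consider the optimization problem $\mathcal{P}_2$ in the variables $v=(v_1,\dots,v_{K+1})\in(0,\infty)^{K+1}$: $$\min_{v_1,\dots,v_{K+1}}\ \sum_{i=1}^{K+1}\bigl(E_{\mathrm{fly},i}(v_i)+E_{\mathrm{hov},i}+E_{\mathrm{com},i}\bigr)$$ subject to (C1) $\displaystyle\sum_{i=1}^{k}\Bigl(\frac{d_i}{v_i}+\tau_{u_i}\Bigr)\le \eta_{u_k}$ for $1\le k\le K$; (C2) $v_i\le V_{\max}$ for $1\le i\le K+1$; (C3) $|v_{i+1}-v_i|\le \Delta V$ for $1\le i\le K$. Then $\mathcal{P}_2$ is a convex optimization problem: the objective is a convex function of $v$ on $(0,\infty)^{K+1}$, and each of the constraints (C1), (C2), (C3) is a convex constraint, i.e. of the form $g(v)\le c$ with $g$ a convex function on $(0,\infty)^{K+1}$ and $c\in\mathbb{R}$.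
   Context: A rotary-wing UAV flies along a fixed path of $K+1$ hops (from its station through ground users $u_1,\dots,u_K$ and back to the station). On hop $i$, of length $d_i$, it flies at constant velocity $v_i>0$. The propulsion power at velocity $v>0$ is $$P_{\mathrm{fly}}(v)=P_0(1+\alpha_1v^2)+P_1\sqrt{\sqrt{1+\alpha_2^2v^4}-\alpha_2v^2}+\alpha_3v^3,$$ with positive constants $P_0,P_1,\alpha_1,\alpha_2,\alpha_3$, and the flying energy on hop $i$ is $$E_{\mathrm{fly},i}(v_i)=P_{\mathrm{fly}}(v_i)\,\frac{d_i}{v_i}.$$ The constants $E_{\mathrm{hov},i}$ and $E_{\mathrm{com},i}$ (hovering and communication energies) do not depend on the velocities; $\tau_k$ is the data transmission time for user $k$ and $\eta_k$ is the requested timeout of user $k$. *)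

theory Defs
  imports "HOL-Analysis.Analysis"
begin

text \<open>
  An inequality-constrained minimisation problem: minimise \<open>objective\<close> over the points of
  \<open>ground_set\<close> that satisfy \<open>g v \<le> c\<close> for every pair \<open>(g, c)\<close> in \<open>constraints\<close>.
\<close>

record 'a min_problem =
  ground_set :: "'a set"
  objective :: "'a \<Rightarrow> real"
  constraints :: "(('a \<Rightarrow> real) \<times> real) set"

definition feasible_set :: "'a min_problem \<Rightarrow> 'a set" where
  "feasible_set Q = {v \<in> ground_set Q. \<forall>(g, c) \<in> constraints Q. g v \<le> c}"

definition convex_problem :: "('a::real_vector) min_problem \<Rightarrow> bool" where
  "convex_problem Q \<longleftrightarrow>
     convex_on (ground_set Q) (objective Q) \<and>
     (\<forall>(g, c) \<in> constraints Q. convex_on (ground_set Q) g)"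

definition P_fly :: "real \<Rightarrow> real \<Rightarrow> real \<Rightarrow> real \<Rightarrow> real \<Rightarrow> real \<Rightarrow> real" where
  "P_fly P0 P1 \<alpha>1 \<alpha>2 \<alpha>3 v =
     P0 * (1 + \<alpha>1 * v^2) + P1 * sqrt (sqrt (1 + \<alpha>2^2 * v^4) - \<alpha>2 * v^2) + \<alpha>3 * v^3"

definition E_fly :: "real \<Rightarrow> real \<Rightarrow> real \<Rightarrow> real \<Rightarrow> real \<Rightarrow> real \<Rightarrow> real \<Rightarrow> real" where
  "E_fly P0 P1 \<alpha>1 \<alpha>2 \<alpha>3 d v = P_fly P0 P1 \<alpha>1 \<alpha>2 \<alpha>3 v * (d / v)"

text \<open>
  The velocity vector is an element of \<open>real ^ 'n\<close>, where \<open>'n\<close> has \<open>K + 1\<close> elements. The map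
  \<open>hop\<close> is meant to be a bijection from \<open>{1..K + 1}\<close> onto \<open>'n\<close>; the velocity on hop \<open>i\<close> is
  \<open>v $ hop i\<close>.
\<close>

definition problem_P2 ::
  "nat \<Rightarrow> (nat \<Rightarrow> 'n) \<Rightarrow> (nat \<Rightarrow> real) \<Rightarrow> real \<Rightarrow> real \<Rightarrow> real \<Rightarrow> real \<Rightarrow> real \<Rightarrow> real \<Rightarrow> real \<Rightarrow>
   (nat \<Rightarrow> real) \<Rightarrow> (nat \<Rightarrow> real) \<Rightarrow> (nat \<Rightarrow> nat) \<Rightarrow> (nat \<Rightarrow> real) \<Rightarrow> (nat \<Rightarrow> real) \<Rightarrow>
   (real ^ 'n::finite) min_problem" where
  "problem_P2 K hop d P0 P1 \<alpha>1 \<alpha>2 \<alpha>3 Vmax \<Delta>V \<tau> \<eta> u Ehov Ecom =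
     \<lparr> ground_set = {v. \<forall>j. 0 < v $ j},
       objective = (\<lambda>v. \<Sum>i = 1..K + 1. E_fly P0 P1 \<alpha>1 \<alpha>2 \<alpha>3 (d i) (v $ hop i) + Ehov i + Ecom i),
       constraints =
         {(\<lambda>v. \<Sum>i = 1..k. d i / v $ hop i + \<tau> (u i), \<eta> (u k)) | k. k \<in> {1..K}} \<union>
         {(\<lambda>v. v $ hop i, Vmax) | i. i \<in> {1..K + 1}} \<union>
         {(\<lambda>v. \<bar>v $ hop (i + 1) - v $ hop i\<bar>, \<Delta>V) | i. i \<in> {1..K}} \<rparr>"

end

(*
  Only the term sqrt (sqrt (1 + a^2 v^4) - a v^2) / v of the flying energy is not visibly convex.
  Its value y > 0 is determined by y^2 (y^2 + 2 a) v^4 = 1, that is, by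
  L y + 4 ln v = 0 with L y = 2 ln y + ln (y^2 + 2 a). Since L is increasing and concave and ln is
  concave, the epigraph {(v, y). L y + 4 ln v >= 0} of this term is convex.
*)

theory Submission
  imports Defs
begin

text \<open>A linear map preserves convex combinations. Later \<open>h\<close> is a single
  coordinate or a difference of two, so that convexity needs checking only for functions of one real
  variable.\<close>

lemma convex_on_compose_linear:
  assumes "convex_on T f" and "linear h" and "convex S" and "h ` S \<subseteq> T"
  shows "convex_on S (\<lambda>x. f (h x))"
proof (rule convex_onI)
  fix t :: real and x y
  assume t: "0 < t" "t < 1" and xy: "x \<in> S" "y \<in> S"
  have "h ((1 - t) *\<^sub>R x + t *\<^sub>R y) = (1 - t) *\<^sub>R h x + t *\<^sub>R h y"
    using \<open>linear h\<close> by (simp add: linear_add linear_cmul)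
  then show "f (h ((1 - t) *\<^sub>R x + t *\<^sub>R y)) \<le> (1 - t) * f (h x) + t * f (h y)"
    using convex_onD[OF assms(1), of t "h x" "h y"] t xy assms(4) by auto
qed fact

lemma convex_on_cong:
  assumes "convex_on S f" and "\<And>x. x \<in> S \<Longrightarrow> f x = g x"
  shows "convex_on S g"
  using assms unfolding convex_on_def by (metis convexD)

lemma convex_on_finite_sum:
  assumes "convex S" and "\<And>i. i \<in> I \<Longrightarrow> convex_on S (f i)"
  shows "convex_on S (\<lambda>x. \<Sum>i\<in>I. f i x)"
  using assms(2)
  by (induction I rule: infinite_finite_induct) (auto simp: convex_on_const \<open>convex S\<close>)

text \<open>The summand \<open>ln (y\<^sup>2 + b)\<close> alone is convex near 0; the second
  derivative \<open>- 2 / y\<^sup>2\<close> of \<open>2 * ln y\<close> outweighs it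
  everywhere.\<close>

lemma concave_on_ln_biquadratic:
  fixes b :: real
  assumes "0 < b"
  shows "concave_on {0<..} (\<lambda>y. 2 * ln y + ln (y\<^sup>2 + b))"
proof (rule f''_le0_imp_concave)
  fix y :: real
  assume "y \<in> {0<..}"
  then have y: "0 < y" by simp
  have b: "0 < y\<^sup>2 + b" using assms by (simp add: add_nonneg_pos)
  show "((\<lambda>y. 2 * ln y + ln (y\<^sup>2 + b)) has_real_derivative 2 / y + 2 * y / (y\<^sup>2 + b)) (at y)"
    using y b by (auto intro!: derivative_eq_intros)
  show "((\<lambda>y. 2 / y + 2 * y / (y\<^sup>2 + b)) has_real_derivative
          - 2 / y\<^sup>2 + 2 * (b - y\<^sup>2) / (y\<^sup>2 + b)\<^sup>2) (at y)"
    using y b by (auto intro!: derivative_eq_intros simp: power2_eq_square algebra_simps)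
  \<comment> \<open>The sign condition on the second derivative with denominators cleared; it holds
    factor by factor, each factor on the left being at most \<open>y\<^sup>2 + b\<close>.\<close>
  have "(b - y\<^sup>2) * y\<^sup>2 \<le> (y\<^sup>2 + b) * (y\<^sup>2 + b)"
    using assms by (intro mult_mono) auto
  then have "(b - y\<^sup>2) / (y\<^sup>2 + b)\<^sup>2 \<le> 1 / y\<^sup>2"
    using y b by (simp add: divide_simps power2_eq_square)
  then have "2 * ((b - y\<^sup>2) / (y\<^sup>2 + b)\<^sup>2) \<le> 2 * (1 / y\<^sup>2)"
    by (rule mult_left_mono) simp
  then show "- 2 / y\<^sup>2 + 2 * (b - y\<^sup>2) / (y\<^sup>2 + b)\<^sup>2 \<le> 0"
    by (simp only: times_divide_eq_right minus_divide_left[symmetric])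
qed simp

text \<open>Strictness is what allows an inequality between values of this function to be carried
  back to its arguments.\<close>

lemma strict_mono_on_ln_biquadratic:
  fixes b :: real
  assumes "0 \<le> b"
  shows "strict_mono_on {0<..} (\<lambda>y. 2 * ln y + ln (y\<^sup>2 + b))"
proof (rule strict_mono_onI)
  fix x y :: real
  assume "x \<in> {0<..}" "y \<in> {0<..}" "x < y"
  then have "ln x < ln y" and "x\<^sup>2 + b < y\<^sup>2 + b" and "0 < x\<^sup>2 + b"
    using assms by (auto intro: power_strict_mono add_pos_nonneg)
  then show "2 * ln x + ln (x\<^sup>2 + b) < 2 * ln y + ln (y\<^sup>2 + b)"
    using ln_mono[of "x\<^sup>2 + b" "y\<^sup>2 + b"] by linarith
qed

text \<open>The summand 1 makes the inner root exceed \<open>a * v\<^sup>2\<close>, whatever the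
  sign of \<open>a\<close>. Positivity puts the term into the domain on which the logarithmic
  function is concave and increasing.\<close>

lemma induced_term_pos:
  fixes a v :: real
  assumes "0 < v"
  shows "0 < sqrt (sqrt (1 + a\<^sup>2 * v ^ 4) - a * v\<^sup>2) / v"
proof -
  have "(a * v\<^sup>2)\<^sup>2 < 1 + a\<^sup>2 * v ^ 4"
    by (simp add: power_mult_distrib)
  then have "a * v\<^sup>2 < sqrt (1 + a\<^sup>2 * v ^ 4)"
    by (rule real_less_rsqrt)
  then show ?thesis using assms by simp
qed

text \<open>With \<open>s\<close> the inner root, \<open>y\<^sup>2\<close> and
  \<open>y\<^sup>2 + 2 * a\<close> are the conjugates \<open>s - a * v\<^sup>2\<close> and
  \<open>s + a * v\<^sup>2\<close> over \<open>v\<^sup>2\<close>. Their product is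
  \<open>1 / v ^ 4\<close>, and the logarithm turns this into a sum.\<close>

lemma ln_biquadratic_induced_term:
  fixes a v :: real
  assumes "0 < a" and v: "0 < v"
  defines "y \<equiv> sqrt (sqrt (1 + a\<^sup>2 * v ^ 4) - a * v\<^sup>2) / v"
  shows "2 * ln y + ln (y\<^sup>2 + 2 * a) = - 4 * ln v"
proof -
  define s where "s = sqrt (1 + a\<^sup>2 * v ^ 4)"
  have y: "0 < y" unfolding y_def using induced_term_pos[OF v] .
  have ss: "s\<^sup>2 = 1 + a\<^sup>2 * v ^ 4" unfolding s_def by simp
  \<comment> \<open>The sign of the radicand is read off from \<open>0 < y\<close>; it is needed for
    squaring to cancel the outer root.\<close>
  have "0 < s - a * v\<^sup>2"
    using y v by (simp add: y_def s_def zero_less_divide_iff)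
  then have y2: "y\<^sup>2 = (s - a * v\<^sup>2) / v\<^sup>2"
    unfolding y_def s_def by (simp add: power_divide)
  have "y\<^sup>2 + 2 * a = (s + a * v\<^sup>2) / v\<^sup>2"
    unfolding y2 using v by (simp add: field_simps)
  then have "y\<^sup>2 * (y\<^sup>2 + 2 * a) = ((s - a * v\<^sup>2) * (s + a * v\<^sup>2)) / v ^ 4"
    unfolding y2 by simp
  also have "(s - a * v\<^sup>2) * (s + a * v\<^sup>2) = 1"
    using ss by (simp add: algebra_simps power2_eq_square eval_nat_numeral)
  finally have "ln (y\<^sup>2 * (y\<^sup>2 + 2 * a)) = ln (1 / v ^ 4)" by simp
  moreover have "0 < y\<^sup>2 + 2 * a" using \<open>0 < a\<close> by (simp add: add_nonneg_pos)
  ultimately show ?thesis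
    using y v by (simp add: ln_mult ln_div ln_realpow)
qed

lemma convex_on_induced_term:
  fixes a :: real
  assumes "0 < a"
  shows "convex_on {0<..} (\<lambda>v. sqrt (sqrt (1 + a\<^sup>2 * v ^ 4) - a * v\<^sup>2) / v)"
    (is "convex_on _ ?g")
proof (rule convex_onI)
  fix t v w :: real
  assume t: "0 < t" "t < 1" and "v \<in> {0<..}" "w \<in> {0<..}"
  then have vw: "0 < v" "0 < w" by auto
  define L where "L = (\<lambda>y. 2 * ln y + ln (y\<^sup>2 + 2 * a))"
  have L: "L (?g x) = - 4 * ln x" if "0 < x" for x
    unfolding L_def using ln_biquadratic_induced_term[OF assms that] .
  define x where "x = (1 - t) * v + t * w"
  \<comment> \<open>\<open>y\<close> is the height of the chord above \<open>x\<close>; the goal is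
    that the point \<open>(x, y)\<close> lies in the epigraph of \<open>?g\<close>.\<close>
  define y where "y = (1 - t) * ?g v + t * ?g w"
  have x: "0 < x" unfolding x_def using t vw by (intro add_pos_pos mult_pos_pos) auto
  have y: "0 < y" unfolding y_def
    using t vw by (intro add_pos_pos mult_pos_pos induced_term_pos) auto
  have "(1 - t) * L (?g v) + t * L (?g w) \<le> L y"
    using concave_onD[OF concave_on_ln_biquadratic[of "2 * a"], of t "?g v" "?g w"]
      assms t induced_term_pos[OF vw(1)] induced_term_pos[OF vw(2)]
    unfolding y_def L_def by simp
  moreover have "(1 - t) * ln v + t * ln w \<le> ln x"
    using concave_onD[OF ln_concave, of t v w] t vw unfolding x_def by simp
  moreover have "(1 - t) * L (?g v) + t * L (?g w) = - 4 * ((1 - t) * ln v + t * ln w)"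
    unfolding L[OF vw(1)] L[OF vw(2)] by (simp add: algebra_simps)
  \<comment> \<open>Concavity of \<open>L\<close> bounds \<open>L y\<close> below by -4 times the
    mean of \<open>ln v\<close> and \<open>ln w\<close>; concavity of \<open>ln\<close>, reversed by
    the factor -4, bounds that below by \<open>- 4 * ln x\<close>, which is
    \<open>L (?g x)\<close>.\<close>
  ultimately have "L (?g x) \<le> L y"
    unfolding L[OF x] by (smt (verit))
  moreover have "strict_mono_on {0<..} L"
    unfolding L_def using strict_mono_on_ln_biquadratic assms by simp
  \<comment> \<open>Otherwise \<open>y < ?g x\<close>, and strict monotonicity would give
    \<open>L y < L (?g x)\<close>.\<close>
  ultimately have "?g x \<le> y"
    using strict_mono_on_leD strict_mono_onD[of "{0<..}" L y "?g x"] induced_term_pos[OF x, of a] y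
    by (meson greaterThan_iff linorder_not_le)
  then show "?g ((1 - t) *\<^sub>R v + t *\<^sub>R w) \<le> (1 - t) * ?g v + t * ?g w"
    unfolding x_def y_def by simp
qed simp

text \<open>Dividing the power by \<open>v\<close> term by term leaves nonnegative multiples of
  \<open>inverse v\<close>, \<open>v\<close>, the induced term and \<open>v\<^sup>2\<close>, each
  convex on the positive half-line.\<close>

lemma convex_on_E_fly:
  assumes "0 \<le> P0" "0 \<le> P1" "0 \<le> \<alpha>1" "0 < \<alpha>2" "0 \<le> \<alpha>3" "0 \<le> d"
  shows "convex_on {0<..} (E_fly P0 P1 \<alpha>1 \<alpha>2 \<alpha>3 d)"
proof -
  let ?g = "\<lambda>v. sqrt (sqrt (1 + \<alpha>2\<^sup>2 * v ^ 4) - \<alpha>2 * v\<^sup>2) / v"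
  have inv: "convex_on {0::real<..} inverse"
    by (rule convex_on_inverse) auto
  have sq: "convex_on {0::real<..} (\<lambda>v. v\<^sup>2)"
    using convex_power2 by (rule convex_on_subset) auto
  have "convex_on {0<..}
          (\<lambda>v. d * ((P0 * inverse v + (P0 * \<alpha>1) * v) + P1 * ?g v + \<alpha>3 * v\<^sup>2))"
    using assms
    by (intro convex_on_cmul convex_on_add inv sq convex_on_induced_term)
      (auto simp: convex_on_ident)
  then show ?thesis
    by (rule convex_on_cong)
      (simp add: E_fly_def P_fly_def field_simps eval_nat_numeral)
qed

text \<open>Turns quantification over the encoded constraint pairs into quantification over their
  indices.\<close>

lemma ball_setcompr: "(\<forall>x\<in>{f k |k. P k}. Q x) \<longleftrightarrow> (\<forall>k. P k \<longrightarrow> Q (f k))"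
  by blast

lemma linear_component: "linear (\<lambda>v :: real ^ 'n. v $ i)"
  by (rule linearI) auto

lemma convex_positive_orthant: "convex {v :: real ^ 'n. \<forall>j. 0 < v $ j}"
proof -
  have "{v :: real ^ 'n. \<forall>j. 0 < v $ j} = (\<Inter>j. (\<lambda>v. v $ j) -` {0<..})"
    by auto
  then show ?thesis
    by (auto intro!: convex_INT convex_linear_vimage linear_component)
qed

lemma convex_on_component:
  assumes "convex_on {0<..} f"
  shows "convex_on {v :: real ^ 'n. \<forall>j. 0 < v $ j} (\<lambda>v. f (v $ i))"
  using assms convex_positive_orthant
  by (rule convex_on_compose_linear[where h = "\<lambda>v. v $ i", OF _ linear_component]) auto

text \<open>The first conjunct ties the encoded constraint set to the explicit (C1), (C2), (C3);
  convexity is then a statement about the intended problem.\<close>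

theorem mainTheorem1:
  fixes K :: nat
    and hop :: "nat \<Rightarrow> 'n::finite"
    and d \<tau> \<eta> Ehov Ecom :: "nat \<Rightarrow> real"
    and u :: "nat \<Rightarrow> nat"
    and P0 P1 \<alpha>1 \<alpha>2 \<alpha>3 Vmax \<Delta>V :: real
  assumes "K \<ge> 1"
    and "bij_betw hop {1..K + 1} UNIV"
    and "\<And>i. i \<in> {1..K + 1} \<Longrightarrow> d i > 0"
    and "P0 > 0" and "P1 > 0" and "\<alpha>1 > 0" and "\<alpha>2 > 0" and "\<alpha>3 > 0"
    and "Vmax > 0" and "\<Delta>V \<ge> 0"
    and "\<And>k. k \<in> {1..K} \<Longrightarrow> \<tau> k \<ge> 0"
    and "bij_betw u {1..K} {1..K}"
  shows "feasible_set (problem_P2 K hop d P0 P1 \<alpha>1 \<alpha>2 \<alpha>3 Vmax \<Delta>V \<tau> \<eta> u Ehov Ecom) =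
           {v. (\<forall>i \<in> {1..K + 1}. 0 < v $ hop i) \<and>
               (\<forall>k \<in> {1..K}. (\<Sum>i = 1..k. d i / v $ hop i + \<tau> (u i)) \<le> \<eta> (u k)) \<and>
               (\<forall>i \<in> {1..K + 1}. v $ hop i \<le> Vmax) \<and>
               (\<forall>i \<in> {1..K}. \<bar>v $ hop (i + 1) - v $ hop i\<bar> \<le> \<Delta>V)}
         \<and> convex_problem (problem_P2 K hop d P0 P1 \<alpha>1 \<alpha>2 \<alpha>3 Vmax \<Delta>V \<tau> \<eta> u Ehov Ecom)"
proof -
  let ?Q = "problem_P2 K hop d P0 P1 \<alpha>1 \<alpha>2 \<alpha>3 Vmax \<Delta>V \<tau> \<eta> u Ehov Ecom"
  let ?S = "{v :: real ^ 'n. \<forall>j. 0 < v $ j}"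
  have d: "0 \<le> d i" if "i \<in> {1..K + 1}" for i
    using assms(3)[OF that] by simp
  \<comment> \<open>Surjectivity of \<open>hop\<close> matches positivity of all coordinates with
    positivity on all hops.\<close>
  have pos: "(\<forall>j. 0 < v $ j) \<longleftrightarrow> (\<forall>i \<in> {1..K + 1}. 0 < v $ hop i)" for v :: "real ^ 'n"
    using bij_betw_imp_surj_on[OF assms(2)] by (metis UNIV_I imageE)
  have feasible: "feasible_set ?Q =
      {v. (\<forall>i \<in> {1..K + 1}. 0 < v $ hop i) \<and>
          (\<forall>k \<in> {1..K}. (\<Sum>i = 1..k. d i / v $ hop i + \<tau> (u i)) \<le> \<eta> (u k)) \<and>
          (\<forall>i \<in> {1..K + 1}. v $ hop i \<le> Vmax) \<and>
          (\<forall>i \<in> {1..K}. \<bar>v $ hop (i + 1) - v $ hop i\<bar> \<le> \<Delta>V)}"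
    unfolding pos[symmetric] feasible_set_def problem_P2_def
    by (simp only: min_problem.simps ball_Un ball_setcompr prod.case mem_Collect_eq)
      (simp only: Ball_def conj_assoc)
  have const: "convex_on ?S (\<lambda>v. c)" for c
    by (simp add: convex_on_const convex_positive_orthant)
  have objective: "convex_on ?S
      (\<lambda>v. \<Sum>i = 1..K + 1. E_fly P0 P1 \<alpha>1 \<alpha>2 \<alpha>3 (d i) (v $ hop i) + Ehov i + Ecom i)"
  proof (rule convex_on_finite_sum[OF convex_positive_orthant])
    fix i
    assume "i \<in> {1..K + 1}"
    then have "convex_on {0<..} (E_fly P0 P1 \<alpha>1 \<alpha>2 \<alpha>3 (d i))"
      using assms(4-8) d by (intro convex_on_E_fly) auto
    then have "convex_on ?S (\<lambda>v. E_fly P0 P1 \<alpha>1 \<alpha>2 \<alpha>3 (d i) (v $ hop i))"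
      by (rule convex_on_component)
    then show "convex_on ?S (\<lambda>v. E_fly P0 P1 \<alpha>1 \<alpha>2 \<alpha>3 (d i) (v $ hop i) + Ehov i + Ecom i)"
      by (intro convex_on_add const)
  qed
  have C1: "convex_on ?S (\<lambda>v. \<Sum>i = 1..k. d i / v $ hop i + \<tau> (u i))" if "k \<in> {1..K}" for k
  proof (rule convex_on_finite_sum[OF convex_positive_orthant])
    fix i
    assume "i \<in> {1..k}"
    then have "0 \<le> d i"
      using d that by simp
    then have "convex_on {0<..} (\<lambda>x. d i * inverse x)"
      by (intro convex_on_cmul convex_on_inverse) auto
    then have "convex_on ?S (\<lambda>v. d i * inverse (v $ hop i))"
      by (rule convex_on_component)
    then show "convex_on ?S (\<lambda>v. d i / v $ hop i + \<tau> (u i))"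
      unfolding divide_inverse by (intro convex_on_add const)
  qed
  have C2: "convex_on ?S (\<lambda>v. v $ hop i)" for i
    by (rule convex_on_component[where f = "\<lambda>x. x"]) (simp add: convex_on_ident)
  \<comment> \<open>The absolute value is the distance from 0, hence convex, and the difference of
    two coordinates is linear.\<close>
  have C3: "convex_on ?S (\<lambda>v. \<bar>v $ i - v $ j\<bar>)" for i j
  proof (rule convex_on_compose_linear[where f = abs and T = UNIV])
    show "convex_on UNIV (abs :: real \<Rightarrow> real)"
      using convex_on_dist[of UNIV "0 :: real"] by (simp add: dist_real_def)
    show "linear (\<lambda>v :: real ^ 'n. v $ i - v $ j)"
      by (intro linear_compose_sub linear_component)
  qed (auto simp: convex_positive_orthant)
  have "convex_problem ?Q"
    unfolding convex_problem_def problem_P2_def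
    using objective C1 C2 C3
    by (simp only: min_problem.simps ball_Un ball_setcompr prod.case) blast
  with feasible show ?thesis ..
qed

end
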